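(* Let $(u,v)$ be a weak solution of the system $$A^2u+C_uAu+k(u-v)=0,\qquad A^2v+C_vAv-k(u-v)=0,$$ where $C_u=\beta+\varrho\|u\|_1^2$ and $C_v=\beta+\varrho\|v\|_1^2$. Then $$u=\sum_n\alpha_ne_n\qquad\text{and}\qquad v=\sum_n\gamma_ne_n$$ for some $\alpha_n,\gamma_n\in\mathbb{R}$, where $\alpha_n\neq0$ for at most three distinct values of $n\in\mathbb{N}$. Moreover, for every $n$, $\alpha_n=0$ if and only if $\gamma_n=0$.
   Context: Let $H$ be a separable real Hilbert space with inner product $\langle\cdot,\cdot\rangle$ and norm $\|\cdot\|$, and let $A:D(A)\subset H\to H$ be a strictly positive selfadjoint linear operator whose domain is densely and compactly embedded in $H$. For $r\ge0$ set $H^r=D(A^{r/2})$, $\langle u,v\rangle_r=\langle A^{r/2}u,A^{r/2}v\rangle$, $\|u\|_r=\|A^{r/2}u\|$. All eigenvalues of $A$ are assumed simple; they form the increasing sequence $0<\lambda_1<\lambda_2<\cdots\to\infty$ ($n\in\mathbb{N}=\{1,2,3,\dots\}$), and the corresponding normalized eigenvectors $e_n$ form a complete orthonormal basis of $H$. Fix $\beta\in\mathbb{R}$ and $\varrho,k>0$. A weak solution of the system is a couple $(u,v)\in H^2\times H^2$ such that $$\langle u,\phi\rangle_2+C_u\langle u,\phi\rangle_1+k\langle u-v,\phi\rangle=0,\qquad \langle v,\psi\rangle_2+C_v\langle v,\psi\rangle_1-k\langle u-v,\psi\rangle=0$$ for every $(\phi,\psi)\in H^2\times H^2$. *)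

theory Defs
  imports "HOL-Analysis.Analysis"
begin

text \<open>
  An unbounded operator on a Hilbert space is a pair of a domain \<open>D\<close> and a total HOL function
  \<open>A\<close>; the values of \<open>A\<close> outside \<open>D\<close> are never referred to.
\<close>

definition densely_defined_operator ::
    "'a::real_inner set \<Rightarrow> ('a \<Rightarrow> 'a) \<Rightarrow> bool" where
  "densely_defined_operator D A \<longleftrightarrow>
     subspace D \<and> closure D = UNIV \<and>
     (\<forall>u\<in>D. \<forall>v\<in>D. A (u + v) = A u + A v) \<and>
     (\<forall>c. \<forall>u\<in>D. A (c *\<^sub>R u) = c *\<^sub>R A u)"

text \<open>The left-hand side below says that \<open>v\<close> lies in the domain of the adjoint and is mapped
  to \<open>w\<close> by it, so the graphs of the adjoint and of \<open>A\<close> coincide, domains included.\<close>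

definition selfadjoint_operator ::
    "'a::real_inner set \<Rightarrow> ('a \<Rightarrow> 'a) \<Rightarrow> bool" where
  "selfadjoint_operator D A \<longleftrightarrow>
     densely_defined_operator D A \<and>
     (\<forall>v w. (\<forall>u\<in>D. A u \<bullet> v = u \<bullet> w) \<longleftrightarrow> (v \<in> D \<and> w = A v))"

definition strictly_positive_operator ::
    "'a::real_inner set \<Rightarrow> ('a \<Rightarrow> 'a) \<Rightarrow> bool" where
  "strictly_positive_operator D A \<longleftrightarrow> (\<forall>u\<in>D. u \<noteq> 0 \<longrightarrow> 0 < A u \<bullet> u)"

text \<open>\<open>D\<close> carries the graph norm; subsets that are bounded for it are relatively compact in
  the whole space.\<close>

definition compactly_embedded_domain ::
    "'a::real_inner set \<Rightarrow> ('a \<Rightarrow> 'a) \<Rightarrow> bool" where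
  "compactly_embedded_domain D A \<longleftrightarrow>
     (\<forall>S\<subseteq>D. bounded S \<and> bounded (A ` S) \<longrightarrow> compact (closure S))"

definition eigenspace_of ::
    "'a::real_inner set \<Rightarrow> ('a \<Rightarrow> 'a) \<Rightarrow> real \<Rightarrow> 'a set" where
  "eigenspace_of D A \<mu> = {u\<in>D. A u = \<mu> *\<^sub>R u}"

definition eigenvalues_of ::
    "'a::real_inner set \<Rightarrow> ('a \<Rightarrow> 'a) \<Rightarrow> real set" where
  "eigenvalues_of D A = {\<mu>. \<exists>u\<in>eigenspace_of D A \<mu>. u \<noteq> 0}"

definition complete_orthonormal_basis :: "(nat \<Rightarrow> 'a::real_inner) \<Rightarrow> bool" where
  "complete_orthonormal_basis e \<longleftrightarrow>
     (\<forall>m n. e m \<bullet> e n = (if m = n then 1 else 0)) \<and> closure (span (range e)) = UNIV"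

text \<open>
  The sequences \<open>lam\<close> and \<open>e\<close> are indexed from \<open>0\<close>, so \<open>lam n\<close> is the eigenvalue
  usually written \<open>\<lambda>\<close> with index \<open>n + 1\<close>.
\<close>

definition simple_eigensystem ::
    "'a::real_inner set \<Rightarrow> ('a \<Rightarrow> 'a) \<Rightarrow> (nat \<Rightarrow> real) \<Rightarrow> (nat \<Rightarrow> 'a) \<Rightarrow> bool" where
  "simple_eigensystem D A lam e \<longleftrightarrow>
     (\<forall>\<mu>\<in>eigenvalues_of D A. dim (eigenspace_of D A \<mu>) = 1) \<and>
     eigenvalues_of D A = range lam \<and>
     0 < lam 0 \<and> strict_mono lam \<and> filterlim lam at_top sequentially \<and>
     (\<forall>n. e n \<in> eigenspace_of D A (lam n)) \<and>
     complete_orthonormal_basis e"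

text \<open>
  Real powers by the functional calculus, which is diagonal in the eigenbasis: a vector is in
  the domain of the power \<open>s\<close> iff the series defining its image converges, equivalently iff
  the squares of its coefficients are summable. The lemma \<open>power_one_eq\<close> below shows that
  the power \<open>1\<close> is \<open>A\<close> itself, with domain exactly \<open>D\<close>.
\<close>

definition power_domain ::
    "(nat \<Rightarrow> real) \<Rightarrow> (nat \<Rightarrow> 'a::real_inner) \<Rightarrow> real \<Rightarrow> 'a set" where
  "power_domain lam e s = {u. summable (\<lambda>n. ((lam n powr s) * (u \<bullet> e n))\<^sup>2)}"

definition power_operator ::
    "(nat \<Rightarrow> real) \<Rightarrow> (nat \<Rightarrow> 'a::real_inner) \<Rightarrow> real \<Rightarrow> 'a \<Rightarrow> 'a" where
  "power_operator lam e s u = (\<Sum>n. ((lam n powr s) * (u \<bullet> e n)) *\<^sub>R e n)"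

definition Hscale ::
    "(nat \<Rightarrow> real) \<Rightarrow> (nat \<Rightarrow> 'a::real_inner) \<Rightarrow> real \<Rightarrow> 'a set" where
  "Hscale lam e r = power_domain lam e (r / 2)"

definition Hinner ::
    "(nat \<Rightarrow> real) \<Rightarrow> (nat \<Rightarrow> 'a::real_inner) \<Rightarrow> real \<Rightarrow> 'a \<Rightarrow> 'a \<Rightarrow> real" where
  "Hinner lam e r u v = power_operator lam e (r / 2) u \<bullet> power_operator lam e (r / 2) v"

definition Hnorm ::
    "(nat \<Rightarrow> real) \<Rightarrow> (nat \<Rightarrow> 'a::real_inner) \<Rightarrow> real \<Rightarrow> 'a \<Rightarrow> real" where
  "Hnorm lam e r u = norm (power_operator lam e (r / 2) u)"

definition Ccoeff ::
    "(nat \<Rightarrow> real) \<Rightarrow> (nat \<Rightarrow> 'a::real_inner) \<Rightarrow> real \<Rightarrow> real \<Rightarrow> 'a \<Rightarrow> real" where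
  "Ccoeff lam e \<beta> \<rho> u = \<beta> + \<rho> * (Hnorm lam e 1 u)\<^sup>2"

definition weak_solution ::
    "(nat \<Rightarrow> real) \<Rightarrow> (nat \<Rightarrow> 'a::real_inner) \<Rightarrow> real \<Rightarrow> real \<Rightarrow> real \<Rightarrow> 'a \<Rightarrow> 'a \<Rightarrow> bool" where
  "weak_solution lam e \<beta> \<rho> k u v \<longleftrightarrow>
     u \<in> Hscale lam e 2 \<and> v \<in> Hscale lam e 2 \<and>
     (\<forall>\<phi>\<in>Hscale lam e 2. \<forall>\<psi>\<in>Hscale lam e 2.
        Hinner lam e 2 u \<phi> + Ccoeff lam e \<beta> \<rho> u * Hinner lam e 1 u \<phi> + k * ((u - v) \<bullet> \<phi>) = 0 \<and>
        Hinner lam e 2 v \<psi> + Ccoeff lam e \<beta> \<rho> v * Hinner lam e 1 v \<psi> - k * ((u - v) \<bullet> \<psi>) = 0)"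

lemma orthonormal_norm_sum:
  fixes e :: "nat \<Rightarrow> 'a::real_inner"
  assumes "complete_orthonormal_basis e" "finite I"
  shows "(norm (\<Sum>n\<in>I. c n *\<^sub>R e n))\<^sup>2 = (\<Sum>n\<in>I. (c n)\<^sup>2)"
proof -
  have o: "e m \<bullet> e n = (if m = n then 1 else 0)" for m n
    using assms(1) by (simp add: complete_orthonormal_basis_def)
  have "(norm (\<Sum>n\<in>I. c n *\<^sub>R e n))\<^sup>2 = (\<Sum>i\<in>I. \<Sum>j\<in>I. c i * (c j * (if i = j then 1 else 0)))"
    by (simp add: power2_norm_eq_inner inner_sum_left inner_sum_right o sum_distrib_left eq_commute
        mult_ac)
  also have "\<dots> = (\<Sum>i\<in>I. (c i)\<^sup>2)"
  proof (rule sum.cong[OF refl])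
    fix i assume "i \<in> I"
    have "(\<Sum>j\<in>I. c i * (c j * (if i = j then 1 else 0))) = (\<Sum>j\<in>I. if i = j then c i * c j else 0)"
      by (rule sum.cong) auto
    then show "(\<Sum>j\<in>I. c i * (c j * (if i = j then 1 else 0))) = (c i)\<^sup>2"
      using \<open>i \<in> I\<close> assms(2) by (simp add: power2_eq_square)
  qed
  finally show ?thesis .
qed

lemma orthonormal_summable:
  fixes e :: "nat \<Rightarrow> 'a::{real_inner, complete_space}"
  assumes e: "complete_orthonormal_basis e" and s: "summable (\<lambda>n. (c n)\<^sup>2)"
  shows "summable (\<lambda>n. c n *\<^sub>R e n)"
proof -
  have "Cauchy (\<lambda>n. \<Sum>i<n. c i *\<^sub>R e i)"
  proof (rule CauchyI')
    fix \<epsilon> :: real assume \<epsilon>: "\<epsilon> > 0"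
    have "\<forall>\<delta>>0. \<exists>N. \<forall>m\<ge>N. \<forall>n. norm (sum (\<lambda>n. (c n)\<^sup>2) {m..<n}) < \<delta>"
      using s by (simp add: summable_Cauchy)
    then obtain N where N: "\<And>m n. m \<ge> N \<Longrightarrow> norm (\<Sum>i\<in>{m..<n}. (c i)\<^sup>2) < \<epsilon>\<^sup>2"
      using \<epsilon> by (metis zero_less_power)
    have "norm ((\<Sum>i<m. c i *\<^sub>R e i) - (\<Sum>i<n. c i *\<^sub>R e i)) < \<epsilon>" if "m \<ge> N" "m < n" for m n
    proof -
      have "(\<Sum>i<n. c i *\<^sub>R e i) - (\<Sum>i<m. c i *\<^sub>R e i) = (\<Sum>i\<in>{m..<n}. c i *\<^sub>R e i)"
        using sum_diff_nat_ivl[of 0 m n "\<lambda>i. c i *\<^sub>R e i"] that by (simp add: lessThan_atLeast0)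
      moreover have "(norm (\<Sum>i\<in>{m..<n}. c i *\<^sub>R e i))\<^sup>2 < \<epsilon>\<^sup>2"
        using N[of m n] that orthonormal_norm_sum[OF e, of "{m..<n}" c] by simp
      ultimately show ?thesis
        using \<epsilon> by (metis norm_minus_commute power2_less_imp_less less_imp_le)
    qed
    then show "\<exists>M. \<forall>m\<ge>M. \<forall>n>m. dist (\<Sum>i<m. c i *\<^sub>R e i) (\<Sum>i<n. c i *\<^sub>R e i) < \<epsilon>"
      unfolding dist_norm by blast
  qed
  then show ?thesis
    by (simp add: summable_iff_convergent Cauchy_convergent_iff)
qed

lemma orthonormal_bessel:
  fixes e :: "nat \<Rightarrow> 'a::real_inner"
  assumes e: "complete_orthonormal_basis e"
  shows "summable (\<lambda>n. (u \<bullet> e n)\<^sup>2)"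
proof (rule summableI_nonneg_bounded[where x = "(norm u)\<^sup>2"])
  fix n
  let ?p = "\<Sum>i<n. (u \<bullet> e i) *\<^sub>R e i"
  have "0 \<le> (u - ?p) \<bullet> (u - ?p)" by simp
  also have "\<dots> = u \<bullet> u - 2 * (u \<bullet> ?p) + (norm ?p)\<^sup>2"
    by (simp add: inner_diff_left inner_diff_right inner_commute power2_norm_eq_inner)
  also have "u \<bullet> ?p = (\<Sum>i<n. (u \<bullet> e i)\<^sup>2)"
    by (simp add: inner_sum_right power2_eq_square)
  also have "(norm ?p)\<^sup>2 = (\<Sum>i<n. (u \<bullet> e i)\<^sup>2)"
    by (rule orthonormal_norm_sum[OF e]) simp
  finally show "(\<Sum>i<n. (u \<bullet> e i)\<^sup>2) \<le> (norm u)\<^sup>2"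
    by (simp add: power2_norm_eq_inner)
qed simp

lemma orthonormal_complete:
  fixes e :: "nat \<Rightarrow> 'a::real_inner"
  assumes e: "complete_orthonormal_basis e" and z: "\<And>n. w \<bullet> e n = 0"
  shows "w = 0"
proof -
  have "span (range e) \<subseteq> {x. w \<bullet> x = 0}"
    by (rule span_minimal) (auto simp: z subspace_def inner_add_right)
  moreover have "closed {x. w \<bullet> x = 0}" by (rule closed_hyperplane)
  ultimately have "closure (span (range e)) \<subseteq> {x. w \<bullet> x = 0}" by (rule closure_minimal)
  then have "w \<in> {x. w \<bullet> x = 0}"
    using e unfolding complete_orthonormal_basis_def by blast
  then have "w \<bullet> w = 0" by blast
  then show ?thesis by simp
qed

lemma orthonormal_coeff:
  fixes e :: "nat \<Rightarrow> 'a::real_inner"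
  assumes e: "complete_orthonormal_basis e" and s: "(\<lambda>n. c n *\<^sub>R e n) sums w"
  shows "w \<bullet> e m = c m"
proof -
  have "(\<lambda>n. (c n *\<^sub>R e n) \<bullet> e m) sums (w \<bullet> e m)"
    by (rule bounded_linear.sums[OF bounded_linear_inner_left s])
  moreover have "(\<lambda>n. (c n *\<^sub>R e n) \<bullet> e m) = (\<lambda>n. if n = m then c n else 0)"
    using e by (auto simp: complete_orthonormal_basis_def)
  ultimately show ?thesis
    using sums_single[of m c] sums_unique2 by metis
qed

lemma power_one_eq:
  fixes A :: "'a::{real_inner, complete_space} \<Rightarrow> 'a"
  assumes sa: "selfadjoint_operator D A" and es: "simple_eigensystem D A lam e"
  shows "power_domain lam e 1 = D" and "\<And>u. u \<in> D \<Longrightarrow> power_operator lam e 1 u = A u"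
proof -
  have e: "complete_orthonormal_basis e" and eD: "\<And>n. e n \<in> D"
    and Ae: "\<And>n. A (e n) = lam n *\<^sub>R e n" and sm: "strict_mono lam" and l0: "0 < lam 0"
    using es by (auto simp: simple_eigensystem_def eigenspace_of_def)
  have lam: "lam n powr 1 = lam n" for n
  proof -
    have "lam 0 \<le> lam n" using sm by (simp add: strict_mono_less_eq)
    with l0 show ?thesis by (simp add: powr_one)
  qed
  have sym: "A u \<bullet> v = u \<bullet> A v" if "u \<in> D" "v \<in> D" for u v
    using sa that by (auto simp: selfadjoint_operator_def)
  have Ac: "A u \<bullet> e n = lam n * (u \<bullet> e n)" if "u \<in> D" for u n
    using sym[OF that eD, of n] by (simp add: Ae)
  have expand: "(\<lambda>n. (lam n * (u \<bullet> e n)) *\<^sub>R e n) sums A u" if "u \<in> D" for u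
  proof -
    have "summable (\<lambda>n. (lam n * (u \<bullet> e n))\<^sup>2)"
      using orthonormal_bessel[OF e, of "A u"] by (simp add: Ac[OF that])
    then obtain w where w: "(\<lambda>n. (lam n * (u \<bullet> e n)) *\<^sub>R e n) sums w"
      using orthonormal_summable[OF e] by (meson summable_def)
    have "w - A u = 0"
      by (rule orthonormal_complete[OF e])
         (simp add: inner_diff_left orthonormal_coeff[OF e w] Ac[OF that])
    with w show ?thesis by simp
  qed
  show "power_operator lam e 1 u = A u" if "u \<in> D" for u
    using expand[OF that] by (simp only: power_operator_def lam sums_iff)
  show "power_domain lam e 1 = D"
  proof (intro equalityI subsetI)
    fix u assume "u \<in> D"
    then show "u \<in> power_domain lam e 1"
      using orthonormal_bessel[OF e, of "A u"] by (simp only: power_domain_def lam Ac mem_Collect_eq)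
  next
    fix u assume "u \<in> power_domain lam e 1"
    then have "summable (\<lambda>n. (lam n * (u \<bullet> e n))\<^sup>2)" by (simp only: power_domain_def lam mem_Collect_eq)
    then obtain w where w: "(\<lambda>n. (lam n * (u \<bullet> e n)) *\<^sub>R e n) sums w"
      using orthonormal_summable[OF e] by (meson summable_def)
    have "A v \<bullet> u = v \<bullet> w" if "v \<in> D" for v
    proof -
      have "(\<lambda>n. ((lam n * (v \<bullet> e n)) *\<^sub>R e n) \<bullet> u) sums (A v \<bullet> u)"
        by (rule bounded_linear.sums[OF bounded_linear_inner_left expand[OF that]])
      moreover have "(\<lambda>n. v \<bullet> ((lam n * (u \<bullet> e n)) *\<^sub>R e n)) sums (v \<bullet> w)"
        by (rule bounded_linear.sums[OF bounded_linear_inner_right w])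
      moreover have "(\<lambda>n. ((lam n * (v \<bullet> e n)) *\<^sub>R e n) \<bullet> u) =
          (\<lambda>n. v \<bullet> ((lam n * (u \<bullet> e n)) *\<^sub>R e n))"
        by (simp add: inner_commute mult_ac)
      ultimately show ?thesis using sums_unique2 by metis
    qed
    then show "u \<in> D" using sa by (auto simp: selfadjoint_operator_def)
  qed
qed

end

theory Submission
  imports Defs
begin

text \<open>
  Testing both equations with \<open>e n\<close> gives a linear system of size two for the coefficients of
  \<open>u\<close> and \<open>v\<close>, with off-diagonal entries \<open>-k\<close>; so one coefficient vanishes iff the
  other does. If they do not vanish, the determinant
  \<open>(\<lambda>\<^sup>2 + C\<^sub>u \<lambda> + k)(\<lambda>\<^sup>2 + C\<^sub>v \<lambda> + k) - k\<^sup>2\<close> is zero at the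
  eigenvalue \<open>\<lambda>\<close>. The constant term cancels, so \<open>\<lambda> > 0\<close> is a root of a monic
  cubic.
\<close>

lemma orthonormal_expansion:
  fixes e :: "nat \<Rightarrow> 'a::{real_inner, complete_space}"
  assumes e: "complete_orthonormal_basis e"
  shows "(\<lambda>n. (u \<bullet> e n) *\<^sub>R e n) sums u"
proof -
  obtain w where w: "(\<lambda>n. (u \<bullet> e n) *\<^sub>R e n) sums w"
    using orthonormal_summable[OF e orthonormal_bessel[OF e]] by (meson summable_def)
  \<comment> \<open>The limit \<open>w\<close> has the same coefficients as \<open>u\<close>, so the
    difference is orthogonal to every basis vector.\<close>
  have "w - u = 0"
    by (rule orthonormal_complete[OF e]) (simp add: inner_diff_left orthonormal_coeff[OF e w])
  with w show ?thesis by simp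
qed

text \<open>Domain membership makes the defining series converge; otherwise \<open>suminf\<close> is
  an unspecified value and no coefficient could be read off.\<close>

lemma power_operator_coeff:
  fixes e :: "nat \<Rightarrow> 'a::{real_inner, complete_space}"
  assumes e: "complete_orthonormal_basis e" and u: "u \<in> power_domain lam e s"
  shows "power_operator lam e s u \<bullet> e m = lam m powr s * (u \<bullet> e m)"
proof -
  have "summable (\<lambda>n. (lam n powr s * (u \<bullet> e n)) *\<^sub>R e n)"
    using u by (intro orthonormal_summable[OF e]) (simp add: power_domain_def)
  then show ?thesis
    unfolding power_operator_def by (intro orthonormal_coeff[OF e] summable_sums)
qed

lemma power_operator_basis:
  fixes e :: "nat \<Rightarrow> 'a::real_inner"
  assumes "complete_orthonormal_basis e"
  shows "power_operator lam e s (e m) = lam m powr s *\<^sub>R e m"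
proof -
  have "(\<lambda>n. (lam n powr s * (e m \<bullet> e n)) *\<^sub>R e n) =
      (\<lambda>n. if n = m then lam n powr s *\<^sub>R e n else 0)"
    using assms by (auto simp: complete_orthonormal_basis_def)
  then show ?thesis
    unfolding power_operator_def
    using sums_unique[OF sums_single[of m "\<lambda>n. lam n powr s *\<^sub>R e n"]] by simp
qed

text \<open>Only one term of the series is nonzero, whatever the exponent; hence basis vectors are
  admissible test vectors.\<close>

lemma basis_in_power_domain:
  fixes e :: "nat \<Rightarrow> 'a::real_inner"
  assumes "complete_orthonormal_basis e"
  shows "e m \<in> power_domain lam e s"
  unfolding power_domain_def using assms
  by (auto simp: complete_orthonormal_basis_def split: if_splits intro!: summable_finite[of "{m}"])

text \<open>Needed because a weak solution is only given in \<open>H^2\<close>, while the equations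
  also contain the inner product of \<open>H^1\<close>. The squared series for \<open>s\<close> is
  dominated by the one for \<open>t\<close> plus the Bessel series, which takes care of the
  eigenvalues below 1.\<close>

lemma power_domain_mono:
  fixes e :: "nat \<Rightarrow> 'a::real_inner"
  assumes e: "complete_orthonormal_basis e" and u: "u \<in> power_domain lam e t"
    and pos: "\<And>n. 0 < lam n" and s: "0 \<le> s" "s \<le> t"
  shows "u \<in> power_domain lam e s"
  unfolding power_domain_def mem_Collect_eq
proof (rule summable_comparison_test')
  show "summable (\<lambda>n. (u \<bullet> e n)\<^sup>2 + (lam n powr t * (u \<bullet> e n))\<^sup>2)"
    using u by (intro summable_add orthonormal_bessel[OF e]) (simp add: power_domain_def)
  fix n :: nat
  have "(lam n powr s)\<^sup>2 \<le> 1 + (lam n powr t)\<^sup>2"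
  proof (cases "lam n \<le> 1")
    case True
    have "lam n powr s \<le> 1"
      using True s pos[of n] by (simp add: powr_le1)
    then have "(lam n powr s)\<^sup>2 \<le> 1" by (simp add: power_le_one)
    then show ?thesis by (smt (verit) zero_le_power2)
  next
    case False
    have "lam n powr s \<le> lam n powr t"
      using False s by (simp add: powr_mono)
    then have "(lam n powr s)\<^sup>2 \<le> (lam n powr t)\<^sup>2" by (simp add: power_mono)
    then show ?thesis by linarith
  qed
  then have "(lam n powr s)\<^sup>2 * (u \<bullet> e n)\<^sup>2 \<le> (1 + (lam n powr t)\<^sup>2) * (u \<bullet> e n)\<^sup>2"
    by (rule mult_right_mono) simp
  then show "norm ((lam n powr s * (u \<bullet> e n))\<^sup>2)
      \<le> (u \<bullet> e n)\<^sup>2 + (lam n powr t * (u \<bullet> e n))\<^sup>2"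
    by (simp add: power_mult_distrib algebra_simps)
qed

text \<open>Each argument of the inner product contributes one factor
  \<open>lam m powr (r / 2)\<close>.\<close>

lemma Hinner_basis:
  fixes e :: "nat \<Rightarrow> 'a::{real_inner, complete_space}"
  assumes "complete_orthonormal_basis e" and "u \<in> Hscale lam e r"
  shows "Hinner lam e r u (e m) = lam m powr r * (u \<bullet> e m)"
  using power_operator_coeff[OF assms(1), of u lam "r / 2" m] assms(2)
  by (simp add: Hinner_def Hscale_def power_operator_basis[OF assms(1)] flip: powr_add)

lemma weak_solution_coeffs:
  fixes e :: "nat \<Rightarrow> 'a::{real_inner, complete_space}"
  assumes e: "complete_orthonormal_basis e" and pos: "\<And>n. 0 < lam n"
    and w: "weak_solution lam e \<beta> \<rho> k u v"
  shows "((lam n)\<^sup>2 + Ccoeff lam e \<beta> \<rho> u * lam n + k) * (u \<bullet> e n) = k * (v \<bullet> e n)"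
    and "((lam n)\<^sup>2 + Ccoeff lam e \<beta> \<rho> v * lam n + k) * (v \<bullet> e n) = k * (u \<bullet> e n)"
proof -
  have *: "Hinner lam e 2 x (e n) = (lam n)\<^sup>2 * (x \<bullet> e n)"
    "Hinner lam e 1 x (e n) = lam n * (x \<bullet> e n)" if "x \<in> Hscale lam e 2" for x
  proof -
    \<comment> \<open>\<open>Hscale\<close> halves its index, so the exponents compared are 1/2 and
      1.\<close>
    have "x \<in> Hscale lam e 1"
      using that power_domain_mono[OF e, of x lam 1 "1/2"] pos by (simp add: Hscale_def)
    then show "Hinner lam e 2 x (e n) = (lam n)\<^sup>2 * (x \<bullet> e n)"
      "Hinner lam e 1 x (e n) = lam n * (x \<bullet> e n)"
      using that pos[of n] by (simp_all add: Hinner_basis[OF e])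
  qed
  have "e n \<in> Hscale lam e 2" by (simp add: Hscale_def basis_in_power_domain[OF e])
  moreover have "u \<in> Hscale lam e 2" "v \<in> Hscale lam e 2"
    using w by (simp_all add: weak_solution_def)
  ultimately have
    "(lam n)\<^sup>2 * (u \<bullet> e n) + Ccoeff lam e \<beta> \<rho> u * (lam n * (u \<bullet> e n))
      + k * ((u - v) \<bullet> e n) = 0"
    "(lam n)\<^sup>2 * (v \<bullet> e n) + Ccoeff lam e \<beta> \<rho> v * (lam n * (v \<bullet> e n))
      - k * ((u - v) \<bullet> e n) = 0"
    using w * unfolding weak_solution_def by metis+
  then show "((lam n)\<^sup>2 + Ccoeff lam e \<beta> \<rho> u * lam n + k) * (u \<bullet> e n) = k * (v \<bullet> e n)"
    "((lam n)\<^sup>2 + Ccoeff lam e \<beta> \<rho> v * lam n + k) * (v \<bullet> e n) = k * (u \<bullet> e n)"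
    by (simp_all add: inner_diff_left algebra_simps)
qed

theorem lemma3p3:
  fixes D :: "'a::{real_inner, complete_space} set"
    and A :: "'a \<Rightarrow> 'a"
    and lam :: "nat \<Rightarrow> real" and e :: "nat \<Rightarrow> 'a"
    and \<beta> \<rho> k :: real and u v :: 'a
  assumes "separable_space (euclidean :: 'a topology)"
    and "selfadjoint_operator D A"
    and "strictly_positive_operator D A"
    and "compactly_embedded_domain D A"
    and "simple_eigensystem D A lam e"
    and "\<rho> > 0" and "k > 0"
    and "weak_solution lam e \<beta> \<rho> k u v"
  shows "\<exists>\<alpha> \<gamma> :: nat \<Rightarrow> real.
           (\<lambda>n. \<alpha> n *\<^sub>R e n) sums u \<and> (\<lambda>n. \<gamma> n *\<^sub>R e n) sums v \<and>
           finite {n. \<alpha> n \<noteq> 0} \<and> card {n. \<alpha> n \<noteq> 0} \<le> 3 \<and>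
           (\<forall>n. \<alpha> n = 0 \<longleftrightarrow> \<gamma> n = 0)"
proof -
  have e: "complete_orthonormal_basis e" and sm: "strict_mono lam" and l0: "0 < lam 0"
    using assms(5) by (auto simp: simple_eigensystem_def)
  have pos: "0 < lam n" for n
    using l0 sm by (metis le0 less_le_trans strict_mono_less_eq)
  \<comment> \<open>Both depend on the solution but not on \<open>n\<close>: once \<open>u\<close>
    and \<open>v\<close> are fixed, the nonlocal coefficients are constants, and a single polynomial
    serves all modes.\<close>
  define c d where "c = Ccoeff lam e \<beta> \<rho> u" and "d = Ccoeff lam e \<beta> \<rho> v"
  have eu: "((lam n)\<^sup>2 + c * lam n + k) * (u \<bullet> e n) = k * (v \<bullet> e n)"
    and ev: "((lam n)\<^sup>2 + d * lam n + k) * (v \<bullet> e n) = k * (u \<bullet> e n)" for n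
    unfolding c_def d_def by (rule weak_solution_coeffs[OF e pos assms(8)])+
  \<comment> \<open>Coefficients, in ascending order, of
    \<open>((x^2 + c*x + k) * (x^2 + d*x + k) - k^2) / x\<close>. Dividing out the root 0 lowers the
    bound from four to three.\<close>
  define p where "p = [:k * (c + d), c * d + 2 * k, c + d, 1:]"
  have "p \<noteq> 0" and "degree p = 3" by (simp_all add: p_def)
  then have fin: "finite {x. poly p x = 0}" and card: "card {x. poly p x = 0} \<le> 3"
    using poly_roots_finite[of p] card_poly_roots_bound[of p] by simp_all
  have root: "poly p (lam n) = 0" if "u \<bullet> e n \<noteq> 0" for n
  proof -
    let ?U = "(lam n)\<^sup>2 + c * lam n + k" and ?V = "(lam n)\<^sup>2 + d * lam n + k"
    \<comment> \<open>Multiply the first relation by \<open>?V\<close> and eliminate the coefficient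
      of \<open>v\<close> with the second.\<close>
    have "?U * ?V * (u \<bullet> e n) = k * k * (u \<bullet> e n)"
      using eu[of n] ev[of n] by (metis mult.assoc mult.commute)
    then have "?U * ?V - k * k = 0" using that by simp
    moreover have "?U * ?V - k * k = lam n * poly p (lam n)"
      by (simp add: p_def power2_eq_square algebra_simps)
    ultimately show ?thesis using pos[of n] by simp
  qed
  \<comment> \<open>Since the eigenvalues are distinct, distinct active modes give distinct roots,
    so counting roots bounds the number of modes.\<close>
  have inj: "inj_on lam {n. u \<bullet> e n \<noteq> 0}"
    using strict_mono_imp_inj_on[OF sm] subset_UNIV by (rule inj_on_subset)
  have sub: "lam ` {n. u \<bullet> e n \<noteq> 0} \<subseteq> {x. poly p x = 0}" using root by auto
  have "finite {n. u \<bullet> e n \<noteq> 0}" using inj_on_finite[OF inj sub fin] .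
  moreover have "card {n. u \<bullet> e n \<noteq> 0} \<le> 3"
    using card_inj_on_le[OF inj sub fin] card by simp
  \<comment> \<open>If one coefficient vanishes, its own relation reduces to \<open>k\<close> times
    the other being zero, and \<open>k > 0\<close>.\<close>
  moreover have "u \<bullet> e n = 0 \<longleftrightarrow> v \<bullet> e n = 0" for n
    using eu[of n] ev[of n] assms(7) by auto
  ultimately show ?thesis
    using orthonormal_expansion[OF e, of u] orthonormal_expansion[OF e, of v]
    by (intro exI[of _ "\<lambda>n. u \<bullet> e n"] exI[of _ "\<lambda>n. v \<bullet> e n"]) simp
qed

end
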